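(* Let $1\le s\le n-1$, $A\in M_{s+1,n-s}(\mathbb R)$, and consider the affine map $\mathbb R^s\to\mathbb R^n$, $\mathbf x\mapsto(\mathbf x,\tilde{\mathbf x}A)$, where $\tilde{\mathbf x}=(1,x_1,\dots,x_s)$. Suppose that either (1) $s=n-1$, or (2) $s=1$ and the first row of $A$ is zero, i.e. $A=\begin{pmatrix}0\\ \mathbf b\end{pmatrix}$ for a row vector $\mathbf b\in\mathbb R^{n-1}$. Then this map is extremal if and only if $A\notin\mathcal W^+_n(s+1,n-s)$.
   Context: Norms are sup-norms. For $A\in M_{m,k}(\mathbb R)$ and $v>0$, $A\in\mathcal W_v(m,k)$ means there are infinitely many $\mathbf q\in\mathbb Z^k$ (column vectors) with $\|A\mathbf q+\mathbf p\|\le\|\mathbf q\|^{-v}$ for some $\mathbf p\in\mathbb Z^m$; $\mathcal W_v^+(m,k)=\bigcup_{u>v}\mathcal W_u(m,k)$. A row vector $\mathbf y\in\mathbb R^n$ is very well approximable (VWA) if $\mathbf y\in\mathcal W_v(1,n)$ for some $v>n$. A map $\mathbf f$ from an open subset of $\mathbb R^d$ to $\mathbb R^n$ is extremal if $\mathbf f(\mathbf x)$ is not VWA for Lebesgue-a.e. $\mathbf x$. *)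

theory Defs
  imports "HOL-Analysis.Analysis"
begin

text \<open>Vectors in R^m are represented as functions nat => real (only the
coordinates i < m matter); matrices in M_{m,k}(R) as functions
nat => nat => real (only entries (i,j) with i < m, j < k matter).\<close>

definition supn :: "nat \<Rightarrow> (nat \<Rightarrow> real) \<Rightarrow> real" where
  "supn m v = Max (insert 0 ((\<lambda>i. \<bar>v i\<bar>) ` {..<m}))"

definition W :: "real \<Rightarrow> nat \<Rightarrow> nat \<Rightarrow> (nat \<Rightarrow> nat \<Rightarrow> real) \<Rightarrow> bool" where
  "W v m k A \<longleftrightarrow>
     infinite {q :: nat \<Rightarrow> int. (\<forall>j\<ge>k. q j = 0) \<and>
        (\<exists>p :: nat \<Rightarrow> int.
           supn m (\<lambda>i. (\<Sum>j<k. A i j * real_of_int (q j)) + real_of_int (p i))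
             \<le> supn k (\<lambda>j. real_of_int (q j)) powr (- v))}"

definition W_plus :: "real \<Rightarrow> nat \<Rightarrow> nat \<Rightarrow> (nat \<Rightarrow> nat \<Rightarrow> real) \<Rightarrow> bool" where
  "W_plus v m k A \<longleftrightarrow> (\<exists>u>v. W u m k A)"

definition VWA :: "nat \<Rightarrow> (nat \<Rightarrow> real) \<Rightarrow> bool" where
  "VWA n y \<longleftrightarrow> (\<exists>v > real n. W v 1 n (\<lambda>i j. y j))"

definition extremal :: "nat \<Rightarrow> nat \<Rightarrow> ((nat \<Rightarrow> real) \<Rightarrow> (nat \<Rightarrow> real)) \<Rightarrow> bool" where
  "extremal d n f \<longleftrightarrow> (AE x in PiM {..<d} (\<lambda>_. lborel). \<not> VWA n (f x))"

definition affmap :: "nat \<Rightarrow> (nat \<Rightarrow> nat \<Rightarrow> real) \<Rightarrow> (nat \<Rightarrow> real) \<Rightarrow> (nat \<Rightarrow> real)" where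
  "affmap s A x = (\<lambda>i. if i < s then x i
                        else A 0 (i - s) + (\<Sum>l<s. x l * A (Suc l) (i - s)))"

end

theory Submission
  imports Defs
begin

text \<open>Write \<open>k = n - s\<close>, and let \<open>w = Aq + p\<close> for integer vectors \<open>q\<close> of length \<open>k\<close> and
  \<open>p\<close> of length \<open>s + 1\<close>. The value at the point \<open>(x, x~A)\<close> of the integer linear form with
  coefficients \<open>(p\<^sub>1, \<dots>, p\<^sub>s, q)\<close> and constant term \<open>p\<^sub>0\<close> is \<open>x~ w\<close>. If \<open>w\<close> is
  very small for infinitely many \<open>q\<close>, then so is \<open>x~ w\<close> for every \<open>x\<close>, and no point of the image
  escapes being very well approximable.

  Conversely, suppose \<open>\<bar>w\<bar> \<ge> c \<bar>q\<bar>\<^sup>-\<^sup>u\<close> with \<open>u\<close> slightly larger than \<open>n\<close>. The points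
  \<open>(q, w)\<close> form a lattice of rank \<open>n + 1\<close>, and the lower bound says that they are sparse: a packing
  argument gives at most \<open>O(\<rho> / r)\<close> of them with \<open>\<bar>q\<bar> \<le> T\<close> and \<open>\<bar>w\<bar> \<le> \<rho>\<close>, where
  \<open>r = c T\<^sup>-\<^sup>u\<close> is the smallest possible value of \<open>\<bar>w\<bar>\<close>. Within a fixed cube the set of \<open>x\<close> with
  \<open>\<bar>x~ w\<bar> \<le> \<epsilon>\<close> has measure \<open>O(\<epsilon> / \<bar>w\<bar>)\<close>, so these sets have total measure
  \<open>O(\<epsilon> / r * ln T)\<close>. With \<open>\<epsilon> = T\<^sup>-\<^sup>v\<close> and \<open>v > u\<close> this is summable over \<open>T = 2\<^sup>t\<close>, and the
  Borel-Cantelli lemma applies.\<close>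

section \<open>Sup-norms and integer vectors\<close>

lemma supn_le_iff: "supn m v \<le> B \<longleftrightarrow> 0 \<le> B \<and> (\<forall>i<m. \<bar>v i\<bar> \<le> B)"
  unfolding supn_def by (subst Max_le_iff) auto

lemma supn_nonneg [simp]: "0 \<le> supn m v"
  unfolding supn_def by (rule Max_ge) auto

lemma abs_le_supn: "i < m \<Longrightarrow> \<bar>v i\<bar> \<le> supn m v"
  unfolding supn_def by (rule Max_ge) auto

lemma supn_attained: "supn m v = 0 \<or> (\<exists>i<m. supn m v = \<bar>v i\<bar>)"
proof -
  have "supn m v \<in> insert 0 ((\<lambda>i. \<bar>v i\<bar>) ` {..<m})"
    unfolding supn_def by (rule Max_in) auto
  then show ?thesis by auto
qed

lemma supn_scale: "supn m (\<lambda>i. a * v i) = \<bar>a\<bar> * supn m v"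
proof (rule antisym)
  show "supn m (\<lambda>i. a * v i) \<le> \<bar>a\<bar> * supn m v"
    by (auto simp: supn_le_iff abs_mult abs_le_supn mult_left_mono)
  show "\<bar>a\<bar> * supn m v \<le> supn m (\<lambda>i. a * v i)"
    using supn_attained[of m v] abs_le_supn[of _ m "\<lambda>i. a * v i"] by (auto simp: abs_mult)
qed

lemma supn_1: "supn 1 v = \<bar>v 0\<bar>"
  by (intro antisym) (auto simp: supn_le_iff intro: abs_le_supn)

lemma supn_Suc: "supn (Suc m) w = max \<bar>w 0\<bar> (supn m (\<lambda>l. w (Suc l)))"
proof (rule antisym)
  show "supn (Suc m) w \<le> max \<bar>w 0\<bar> (supn m (\<lambda>l. w (Suc l)))"
    using abs_le_supn[of _ m "\<lambda>l. w (Suc l)"]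
    by (fastforce simp: supn_le_iff less_Suc_eq_0_disj le_max_iff_disj)
  show "max \<bar>w 0\<bar> (supn m (\<lambda>l. w (Suc l))) \<le> supn (Suc m) w"
    by (auto simp: supn_le_iff intro: abs_le_supn)
qed

text \<open>Forcing zeros beyond the first \<open>k\<close> coordinates gives each integer vector
  exactly one representing function, so finiteness and injectivity of sets of functions concern
  vectors.\<close>

definition intvec :: "nat \<Rightarrow> (nat \<Rightarrow> int) set" where
  "intvec k = {q. \<forall>j\<ge>k. q j = 0}"

lemma supn_intvec_eq_of_nat: "\<exists>N::nat. supn k (\<lambda>j. real_of_int (q j)) = real N"
proof -
  have "supn k (\<lambda>j. real_of_int (q j)) = real (nat \<bar>q j\<bar>)"
    if "supn k (\<lambda>j. real_of_int (q j)) = \<bar>real_of_int (q j)\<bar>" for j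
    using that by simp
  then show ?thesis
    using supn_attained[of k "\<lambda>j. real_of_int (q j)"] by (metis of_nat_0)
qed

lemma supn_intvec_ge_1:
  assumes "q \<in> intvec k" "q \<noteq> (\<lambda>_. 0)"
  shows "1 \<le> supn k (\<lambda>j. real_of_int (q j))"
proof -
  obtain j where j: "q j \<noteq> 0" using assms(2) by auto
  then have "j < k" using assms(1) by (auto simp: intvec_def not_le[symmetric])
  then show ?thesis using abs_le_supn[of j k "\<lambda>j. real_of_int (q j)"] j by linarith
qed

lemma finite_intvec_le: "finite {q \<in> intvec k. supn k (\<lambda>j. real_of_int (q j)) \<le> B}"
proof (rule finite_subset)
  let ?I = "{- \<lceil>B\<rceil>..\<lceil>B\<rceil>}"
  show "finite {f. \<forall>i. (i \<in> {..<k} \<longrightarrow> f i \<in> ?I) \<and> (i \<notin> {..<k} \<longrightarrow> f i = (0::int))}"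
    by (rule finite_set_of_finite_funs) auto
  show "{q \<in> intvec k. supn k (\<lambda>j. real_of_int (q j)) \<le> B}
      \<subseteq> {f. \<forall>i. (i \<in> {..<k} \<longrightarrow> f i \<in> ?I) \<and> (i \<notin> {..<k} \<longrightarrow> f i = (0::int))}"
  proof safe
    fix q i assume q: "supn k (\<lambda>j. real_of_int (q j)) \<le> B" "i < k"
    then have "\<bar>real_of_int (q i)\<bar> \<le> B" by (simp add: supn_le_iff)
    then have "\<bar>real_of_int (q i)\<bar> \<le> real_of_int \<lceil>B\<rceil>" by linarith
    then show "q i \<in> ?I" by auto
  qed (auto simp: intvec_def, meson not_le)
qed

section \<open>Integer linear forms on the affine subspace\<close>

definition lin :: "nat \<Rightarrow> (nat \<Rightarrow> nat \<Rightarrow> real) \<Rightarrow> (nat \<Rightarrow> int) \<Rightarrow> (nat \<Rightarrow> int) \<Rightarrow> nat \<Rightarrow> real" where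
  "lin k A q p = (\<lambda>i. (\<Sum>j<k. A i j * real_of_int (q j)) + real_of_int (p i))"

text \<open>This is x~ w with x~ = (1, x_1, ..., x_s); the entry \<open>w 0\<close> is the
  coefficient of 1.\<close>

definition form :: "nat \<Rightarrow> (nat \<Rightarrow> real) \<Rightarrow> (nat \<Rightarrow> real) \<Rightarrow> real" where
  "form s x w = w 0 + (\<Sum>l<s. x l * w (Suc l))"

definition approx_set :: "real \<Rightarrow> nat \<Rightarrow> nat \<Rightarrow> (nat \<Rightarrow> nat \<Rightarrow> real) \<Rightarrow> (nat \<Rightarrow> int) set" where
  "approx_set v m k A =
     {q \<in> intvec k. \<exists>p. supn m (lin k A q p) \<le> supn k (\<lambda>j. real_of_int (q j)) powr (- v)}"

lemma W_iff: "W v m k A \<longleftrightarrow> infinite (approx_set v m k A)"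
  by (simp add: W_def approx_set_def intvec_def lin_def)

text \<open>Monotonicity in the exponent needs a base at least 1. Integrality leaves only the norm 0
  besides, where \<open>powr\<close> yields 0 for every exponent.\<close>

lemma approx_set_antimono: "v \<le> v' \<Longrightarrow> approx_set v' m k A \<subseteq> approx_set v m k A"
proof
  fix q assume v: "v \<le> v'" and q: "q \<in> approx_set v' m k A"
  let ?Q = "supn k (\<lambda>j. real_of_int (q j))"
  have "?Q powr (- v') \<le> ?Q powr (- v)"
    using v supn_intvec_eq_of_nat[of k q] by (cases "?Q = 0") (auto intro!: powr_mono)
  then show "q \<in> approx_set v m k A"
    using q unfolding approx_set_def by (auto intro: order_trans)
qed

lemma lin_diff: "lin k A (\<lambda>j. q j - q' j) (\<lambda>i. p i - p' i) i = lin k A q p i - lin k A q' p' i"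
  by (simp add: lin_def algebra_simps sum_subtractf)

lemma lin_scale: "lin k A (\<lambda>j. a * q j) (\<lambda>i. a * p i) = (\<lambda>i. real_of_int a * lin k A q p i)"
  by (auto simp: lin_def algebra_simps sum_distrib_left)

lemma abs_form_le:
  assumes "\<forall>i\<le>s. \<bar>w i\<bar> \<le> B"
  shows "\<bar>form s x w\<bar> \<le> (1 + (\<Sum>l<s. \<bar>x l\<bar>)) * B"
proof -
  have "\<bar>\<Sum>l<s. x l * w (Suc l)\<bar> \<le> (\<Sum>l<s. \<bar>x l\<bar> * B)"
    using assms by (intro order_trans[OF sum_abs] sum_mono) (auto simp: abs_mult intro!: mult_left_mono)
  moreover have "\<bar>w 0\<bar> \<le> B" using assms by auto
  ultimately show ?thesis by (simp add: form_def algebra_simps sum_distrib_left)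
qed

text \<open>The first \<open>s\<close> coefficients of an integer form on R^n become entries 1, ...,
  s of p, the others become q. Swapping the double sum collects the coefficient of each
  \<open>x l\<close>. This links image points with \<open>A\<close>.\<close>

lemma form_affmap:
  assumes "s \<le> n"
  shows "(\<Sum>j<n. affmap s A x j * real_of_int (a j)) + real_of_int (p 0)
       = form s x (lin (n - s) A (\<lambda>j. a (s + j)) (\<lambda>i. if i = 0 then p 0 else a (i - 1)))"
proof -
  have "(\<Sum>j<n. affmap s A x j * real_of_int (a j)) =
      (\<Sum>j<s. affmap s A x j * real_of_int (a j)) +
      (\<Sum>j<n-s. affmap s A x (s + j) * real_of_int (a (s + j)))"
    using assms by (simp add: sum.nat_group add.commute lessThan_atLeast0
      sum.atLeastLessThan_concat[of 0 s n, symmetric] sum.atLeastLessThan_shift_0[of _ s n])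
  also have "(\<Sum>j<s. affmap s A x j * real_of_int (a j)) = (\<Sum>l<s. x l * real_of_int (a l))"
    by (auto simp: affmap_def)
  also have "(\<Sum>j<n-s. affmap s A x (s + j) * real_of_int (a (s + j))) =
      (\<Sum>j<n-s. A 0 j * real_of_int (a (s + j)))
        + (\<Sum>j<n-s. \<Sum>l<s. x l * (A (Suc l) j * real_of_int (a (s + j))))"
    by (auto simp: affmap_def algebra_simps sum_distrib_left sum.distrib)
  also have "(\<Sum>j<n-s. \<Sum>l<s. x l * (A (Suc l) j * real_of_int (a (s + j)))) =
      (\<Sum>l<s. x l * (\<Sum>j<n-s. A (Suc l) j * real_of_int (a (s + j))))"
    by (subst sum.swap) (simp add: sum_distrib_left)
  finally show ?thesis
    by (simp add: form_def lin_def algebra_simps sum.distrib)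
qed

text \<open>Replacing \<open>q\<close> by a large multiple moves it outside any given finite set.\<close>

lemma not_W_lower_bound:
  assumes "\<not> W u m k A"
  obtains c where "0 < c" "c \<le> 1"
    "\<And>q p. q \<in> intvec k \<Longrightarrow> q \<noteq> (\<lambda>_. 0) \<Longrightarrow>
       c * supn k (\<lambda>j. real_of_int (q j)) powr (- u) \<le> supn m (lin k A q p)"
proof -
  let ?N = "\<lambda>q. supn k (\<lambda>j. real_of_int (q j))"
  have fin: "finite (?N ` approx_set u m k A)" using assms by (simp add: W_iff)
  then obtain B where B: "\<And>q. q \<in> approx_set u m k A \<Longrightarrow> ?N q \<le> B"
    by (meson bdd_above.unfold bdd_above_finite image_eqI)
  \<comment> \<open>\<open>M\<close> exceeds every norm in the finite exceptional set, so
    \<open>M\<close> times a nonzero integer vector lies outside it.\<close>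
  define M where "M = max 1 (nat (\<lfloor>B\<rfloor> + 1))"
  have M: "1 \<le> M" "B < real M" unfolding M_def by linarith+
  \<comment> \<open>Passing back from the multiple to \<open>q\<close> costs the factors M^(-u) and
    1 / M. The minimum with 1 is for the counting bound.\<close>
  define c where "c = min 1 (real M powr (- u) / real M)"
  have "0 < c" "c \<le> 1" using M by (auto simp: c_def)
  moreover have "c * ?N q powr (- u) \<le> supn m (lin k A q p)"
    if q: "q \<in> intvec k" "q \<noteq> (\<lambda>_. 0)" for q p
  proof -
    let ?q = "\<lambda>j. int M * q j"
    have NM: "?N ?q = real M * ?N q" using supn_scale[of k "real M"] by simp
    have "1 \<le> ?N q" using q by (rule supn_intvec_ge_1)
    then have "real M * 1 \<le> ?N ?q" unfolding NM using M by (intro mult_left_mono) auto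
    then have "?q \<notin> approx_set u m k A" using B[of ?q] M by force
    moreover have "?q \<in> intvec k" using q by (auto simp: intvec_def)
    ultimately have "?N ?q powr (- u) < supn m (lin k A ?q (\<lambda>i. int M * p i))"
      by (auto simp: approx_set_def not_le)
    then have "(real M * ?N q) powr (- u) < real M * supn m (lin k A q p)"
      unfolding lin_scale supn_scale NM by simp
    then have "real M powr (- u) / real M * ?N q powr (- u) < supn m (lin k A q p)"
      using M by (simp add: powr_mult field_simps)
    moreover have "c * ?N q powr (- u) \<le> real M powr (- u) / real M * ?N q powr (- u)"
      by (intro mult_right_mono) (auto simp: c_def)
    ultimately show ?thesis by linarith
  qed
  ultimately show ?thesis using that by blast
qed

section \<open>Counting lattice points\<close>

text \<open>Cut the box \<open>\<bar>q\<bar> \<le> T\<close>, \<open>\<bar>w\<bar> \<le> \<rho>\<close> in dimension \<open>d = k + m\<close> into cells that are scaled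
  copies of it by a factor \<open>h\<close>. The lower bound on \<open>supn m (lin k A q p)\<close> prevents two points
  from falling into the same cell as soon as \<open>h ^ d\<close> is a small multiple of \<open>r / \<rho>\<close>.\<close>

lemma card_lin_points_le:
  fixes A :: "nat \<Rightarrow> nat \<Rightarrow> real" and T \<rho> D c u :: real
  assumes d: "d = k + m" "1 \<le> d" and u: "real d - 1 \<le> u" and c: "0 < c" "c \<le> 1"
    and low: "\<And>q p. q \<in> intvec k \<Longrightarrow> q \<noteq> (\<lambda>_. 0) \<Longrightarrow>
       c * supn k (\<lambda>j. real_of_int (q j)) powr (- u) \<le> supn m (lin k A q p)"
    and T: "1 \<le> T" and D: "1 \<le> D" and r: "r = c * T powr (- u)" and \<rho>: "r \<le> \<rho>" "\<rho> \<le> D * T"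
  defines "P \<equiv> {(q, p). q \<in> intvec k \<and> p \<in> intvec m \<and>
     supn k (\<lambda>j. real_of_int (q j)) \<le> T \<and> supn m (lin k A q p) \<le> \<rho>}"
  shows "finite P" and "real (card P) \<le> (4 * D) ^ d * \<rho> / r"
proof -
  have u0: "0 \<le> u" using u d by linarith
  have r0: "0 < r" using r c T by simp
  have \<rho>0: "0 < \<rho>" using r0 \<rho> by simp
  \<comment> \<open>That h^d is at most r / \<rho> will separate points with different q; the
    division by \<open>D\<close> makes h \<rho> at most 1, which separates points with the same
    q.\<close>
  define h where "h = root d (r / \<rho>) / D"
  have hd: "h ^ d = r / \<rho> / D ^ d"
    unfolding h_def power_divide using r0 \<rho>0 d(2) by (simp add: real_root_pow_pos2)
  have h0: "0 < h" unfolding h_def using r0 \<rho>0 d(2) D by simp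
  have hd_le: "h ^ d \<le> r / \<rho>"
    unfolding hd using D r0 \<rho>0 by (simp add: divide_le_eq mult_right_mono[of 1 "D ^ d" "r / \<rho>", simplified])
  have h1: "h \<le> 1"
  proof -
    have "h ^ d \<le> 1" using hd_le \<rho> r0 by (auto intro: order_trans)
    then show ?thesis using d(2) h0 by (simp add: power_le_one_iff)
  qed
  have h\<rho>: "h * \<rho> \<le> 1"
  proof -
    obtain e where e: "d = Suc e" using d(2) by (cases d) auto
    \<comment> \<open>One factor \<rho> cancels against h^d, the other d - 1 are at most D T, and
      T^(d - 1) is absorbed by the T^(-u) in r because d - 1 <= u.\<close>
    have "(h * \<rho>) ^ d = r / D ^ d * \<rho> ^ e"
      unfolding power_mult_distrib hd using \<rho>0 by (simp add: e)
    also have "\<dots> \<le> r / D ^ d * (D * T) ^ e"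
      using \<rho> \<rho>0 r0 D by (intro mult_left_mono power_mono) auto
    also have "\<dots> = c * (T powr (- u) * T powr (real e)) / D"
      using D T by (simp add: r e power_mult_distrib powr_realpow)
    also have "T powr (- u) * T powr (real e) \<le> T powr 0"
      unfolding powr_add[symmetric] using u e T by (intro powr_mono) auto
    also have "c * T powr 0 / D \<le> 1" using c D T by (simp add: divide_le_eq)
    finally have "(h * \<rho>) ^ d \<le> 1" using c D by (simp add: mult_left_mono divide_right_mono)
    then show ?thesis using d(2) h0 \<rho>0 by (simp add: power_le_one_iff)
  qed
  \<comment> \<open>The right side bounds from below the size of w for a nonzero q of norm less than
    h T, the left side is the cell width in w. The inequality comes from h^(1 + u) <= h^d, as h <= 1
    and d <= 1 + u.\<close>
  have hu: "h * \<rho> \<le> c * (h * T) powr (- u)"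
  proof -
    have "h powr (1 + u) \<le> h powr (real d)"
      using h0 h1 u by (intro powr_mono') auto
    also have "\<dots> \<le> r / \<rho>" using hd_le h0 by (simp add: powr_realpow)
    finally have "h * h powr u * \<rho> \<le> r" using h0 \<rho>0 by (simp add: powr_add field_simps)
    then have "h * \<rho> \<le> r * h powr (- u)" using h0 by (simp add: powr_minus field_simps)
    then show ?thesis using h0 T by (simp add: r powr_mult mult_ac)
  qed
  define cell :: "(nat \<Rightarrow> int) \<times> (nat \<Rightarrow> int) \<Rightarrow> nat \<Rightarrow> int" where
    "cell = (\<lambda>(q, p). \<lambda>i\<in>{..<d}. if i < k then \<lfloor>q i / (h * T)\<rfloor>
       else \<lfloor>lin k A q p (i - k) / (h * \<rho>)\<rfloor>)"
  have floor_diff: "\<bar>a - b\<bar> < g" if "\<lfloor>a / g\<rfloor> = \<lfloor>b / g\<rfloor>" "0 < g" for a b g :: real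
  proof -
    have "\<bar>a / g - b / g\<bar> < 1" using that(1) by linarith
    then show ?thesis using that(2) by (simp flip: diff_divide_distrib add: divide_less_eq)
  qed
  have inj: "inj_on cell P"
  proof (rule inj_onI, clarify)
    fix q p q' p' assume in_P: "(q, p) \<in> P" "(q', p') \<in> P" and eq: "cell (q, p) = cell (q', p')"
    let ?q = "\<lambda>j. q j - q' j" and ?p = "\<lambda>i. p i - p' i"
    have "\<lfloor>q i / (h * T)\<rfloor> = \<lfloor>q' i / (h * T)\<rfloor>" if "i < k" for i
      using fun_cong[OF eq, of i] that d by (simp add: cell_def)
    then have dq: "\<bar>real_of_int (?q i)\<bar> < h * T" if "i < k" for i
      using floor_diff[of "q i" "h * T" "q' i"] that h0 T by simp
    have "\<lfloor>lin k A q p i / (h * \<rho>)\<rfloor> = \<lfloor>lin k A q' p' i / (h * \<rho>)\<rfloor>" if "i < m" for i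
      using fun_cong[OF eq, of "k + i"] that d by (simp add: cell_def)
    then have dw: "\<bar>lin k A ?q ?p i\<bar> < h * \<rho>" if "i < m" for i
      unfolding lin_diff using floor_diff that h0 \<rho>0 by simp
    have iv: "q \<in> intvec k" "q' \<in> intvec k" "p \<in> intvec m" "p' \<in> intvec m"
      using in_P by (auto simp: P_def)
    have "?q = (\<lambda>_. 0)"
    proof (rule ccontr)
      assume neq: "?q \<noteq> (\<lambda>_. 0)"
      let ?N = "supn k (\<lambda>j. real_of_int (?q j))"
      have q: "?q \<in> intvec k" using iv by (auto simp: intvec_def)
      have N: "1 \<le> ?N" using q neq by (rule supn_intvec_ge_1)
      then have "?N < h * T"
        using supn_attained[of k "\<lambda>j. real_of_int (?q j)"] dq by auto
      then have "(h * T) powr (- u) \<le> ?N powr (- u)" using u0 N by (intro powr_mono2') auto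
      then have "c * (h * T) powr (- u) \<le> c * ?N powr (- u)" using c by simp
      also have "\<dots> \<le> supn m (lin k A ?q ?p)" using q neq by (rule low)
      also have "\<dots> < h * \<rho>"
        using supn_attained[of m "lin k A ?q ?p"] dw h0 \<rho>0 by auto
      finally show False using hu by simp
    qed
    then have qq: "q j = q' j" for j by (metis eq_iff_diff_eq_0)
    have "p i = p' i" for i
    proof (cases "i < m")
      case True
      have "\<bar>real_of_int (?p i)\<bar> < 1" using dw[OF True] h\<rho> qq by (simp add: lin_def)
      then show ?thesis by linarith
    qed (use iv in \<open>auto simp: intvec_def\<close>)
    with qq show "q = q' \<and> p = p'" by auto
  qed
  \<comment> \<open>The possible cell indices in one coordinate: at most 2 / h + 2 of them, hence at
    most 4 / h.\<close>
  let ?J = "{\<lfloor>- (1 / h)\<rfloor>..\<lfloor>1 / h\<rfloor>}"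
  have sub: "cell ` P \<subseteq> PiE {..<d} (\<lambda>_. ?J)"
  proof (rule image_subsetI)
    fix z assume "z \<in> P"
    then obtain q p where z: "z = (q, p)" and in_P: "(q, p) \<in> P" by (cases z) auto
    have fl: "\<lfloor>a / (h * g)\<rfloor> \<in> ?J" if "\<bar>a\<bar> \<le> g" "0 < g" for a g :: real
    proof -
      have "a \<le> g" "- g \<le> a" using that by linarith+
      then have "a / (h * g) \<le> 1 / h" "- (1 / h) \<le> a / (h * g)"
        using that h0 by (simp_all add: field_simps)
      then show ?thesis by (auto intro!: floor_mono)
    qed
    have "\<bar>real_of_int (q i)\<bar> \<le> T" if "i < k" for i
      using in_P that by (auto simp: P_def supn_le_iff)
    moreover have "\<bar>lin k A q p (i - k)\<bar> \<le> \<rho>" if "i < d" "\<not> i < k" for i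
      using in_P that d by (auto simp: P_def supn_le_iff)
    ultimately show "cell z \<in> PiE {..<d} (\<lambda>_. ?J)"
      unfolding z using fl T \<rho>0 d by (auto simp: cell_def PiE_iff simp del: atLeastAtMost_iff)
  qed
  have fin: "finite (PiE {..<d} (\<lambda>_. ?J))" by (intro finite_PiE) auto
  show "finite P" using inj sub fin by (meson finite_imageD finite_subset)
  have "card P \<le> card (PiE {..<d} (\<lambda>_. ?J))" using inj sub fin by (rule card_inj_on_le)
  also have "\<dots> = card ?J ^ d" by (simp add: card_PiE)
  finally have "real (card P) \<le> real (card ?J) ^ d" by (simp flip: of_nat_power)
  also have "real (card ?J) \<le> 4 / h"
  proof -
    have "1 \<le> 1 / h" using h0 h1 by simp
    moreover have "real (card ?J) \<le> 1 / h + 1 / h + 2"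
    proof -
      have "- (1 / h) \<le> 1 / h" using h0 by simp
      then have "\<lfloor>- (1 / h)\<rfloor> \<le> \<lfloor>1 / h\<rfloor>" by (rule floor_mono)
      then show ?thesis by (simp; linarith)
    qed
    ultimately show ?thesis by (simp add: field_simps)
  qed
  then have "real (card ?J) ^ d \<le> (4 / h) ^ d" by (intro power_mono) auto
  also have "\<dots> = (4 * D) ^ d * \<rho> / r"
    unfolding power_divide hd using D by (simp add: power_mult_distrib)
  finally show "real (card P) \<le> (4 * D) ^ d * \<rho> / r" .
qed

text \<open>In increasing order, the j-th value of \<open>f\<close> is at least j / B, so its
  reciprocal is at most B / j. The induction removes a point where \<open>f\<close> is
  largest.\<close>

lemma sum_inverse_le_harm:
  fixes f :: "'a \<Rightarrow> real"
  assumes "finite I" and "\<And>z. z \<in> I \<Longrightarrow> 0 < f z"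
    and "\<And>z. z \<in> I \<Longrightarrow> real (card {y \<in> I. f y \<le> f z}) \<le> B * f z"
  shows "(\<Sum>z\<in>I. 1 / f z) \<le> B * harm (card I)"
  using assms
proof (induction "card I" arbitrary: I)
  case 0
  then show ?case by (simp add: harm_def)
next
  case (Suc N)
  then have "I \<noteq> {}" by auto
  then have "Max (f ` I) \<in> f ` I" using Suc.prems(1) by simp
  then obtain z where max: "Max (f ` I) = f z" and "z \<in> I" by (rule imageE)
  then have z: "z \<in> I" "\<And>y. y \<in> I \<Longrightarrow> f y \<le> f z"
    using Suc.prems(1) by (auto simp flip: max)
  have card: "card (I - {z}) = N" using z Suc by (simp add: Suc.prems(1))
  have "{y \<in> I. f y \<le> f z} = I" using z by auto
  then have "real (Suc N) \<le> B * f z" using Suc.prems(3)[OF z(1)] Suc.hyps(2) by simp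
  then have "1 / f z \<le> B * inverse (real (Suc N))"
    using Suc.prems(2)[OF z(1)] by (simp add: field_simps)
  moreover have "(\<Sum>y\<in>I - {z}. 1 / f y) \<le> B * harm (card (I - {z}))"
  proof (rule Suc.hyps(1))
    fix y assume y: "y \<in> I - {z}"
    have "real (card {x \<in> I - {z}. f x \<le> f y}) \<le> real (card {x \<in> I. f x \<le> f y})"
      using Suc.prems(1) by (intro of_nat_mono card_mono) auto
    then show "real (card {x \<in> I - {z}. f x \<le> f y}) \<le> B * f y"
      using Suc.prems(3)[of y] y by simp
  qed (use Suc.prems card in auto)
  moreover have "(\<Sum>y\<in>I. 1 / f y) = 1 / f z + (\<Sum>y\<in>I - {z}. 1 / f y)"
    using Suc.prems(1) z(1) by (rule sum.remove)
  moreover have "harm (card I) = harm N + inverse (real (Suc N))"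
    unfolding Suc.hyps(2)[symmetric] by (simp add: harm_Suc)
  ultimately show ?case by (simp add: card algebra_simps)
qed

lemma harm_le_one_plus_ln: "1 \<le> n \<Longrightarrow> harm n \<le> 1 + ln (real n)"
  using euler_mascheroni_sequence_decreasing[of 1 n] by (simp add: harm_def)

section \<open>Measure of the neighbourhood of a hyperplane\<close>

interpretation lborel_PiM: product_sigma_finite "\<lambda>_::nat. lborel :: real measure"
  by standard

definition strip :: "nat \<Rightarrow> real \<Rightarrow> (nat \<Rightarrow> real) \<Rightarrow> real \<Rightarrow> (nat \<Rightarrow> real) set" where
  "strip s K w \<epsilon> = {x \<in> space (PiM {..<s} (\<lambda>_. lborel)). (\<forall>i\<in>{..<s}. \<bar>x i\<bar> \<le> K) \<and> \<bar>form s x w\<bar> \<le> \<epsilon>}"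

lemma sets_strip [measurable]: "strip s K w \<epsilon> \<in> sets (PiM {..<s} (\<lambda>_. lborel))"
  unfolding strip_def form_def by measurable

lemma emeasure_cube:
  assumes "finite I" "0 \<le> K"
  shows "emeasure (PiM I (\<lambda>_::nat. lborel)) (PiE I (\<lambda>_. {- K..K::real})) = ennreal ((2 * K) ^ card I)"
  using assms by (subst lborel_PiM.emeasure_PiM) (auto simp: ennreal_power)

text \<open>Fubini in coordinate \<open>l\<close>: with the others fixed, the form is affine in
  \<open>x l\<close> with slope \<open>w (Suc l)\<close>, so \<open>x l\<close> stays in an interval
  of length 2 \<epsilon> / |w (Suc l)|, while the others range over a cube of dimension s -
  1.\<close>

lemma emeasure_strip_le_coordinate:
  assumes l: "l < s" "w (Suc l) \<noteq> 0" and \<epsilon>: "0 \<le> \<epsilon>" and K: "0 \<le> K"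
  shows "emeasure (PiM {..<s} (\<lambda>_. lborel)) (strip s K w \<epsilon>)
    \<le> ennreal ((2 * K) ^ (s - 1) * (2 * \<epsilon> / \<bar>w (Suc l)\<bar>))"
proof -
  define I where "I = {..<s} - {l}"
  have I: "insert l I = {..<s}" "finite I" "l \<notin> I" "card I = s - 1"
    using l by (auto simp: I_def)
  let ?M = "PiM I (\<lambda>_::nat. lborel :: real measure)"
  define b where "b = w (Suc l)"
  have b: "b \<noteq> 0" using l by (simp add: b_def)
  define a where "a x = w 0 + (\<Sum>i\<in>I. x i * w (Suc i))" for x :: "nat \<Rightarrow> real"
  define J where "J x = {- a x / b - \<epsilon> / \<bar>b\<bar>..- a x / b + \<epsilon> / \<bar>b\<bar>}" for x
  define R where "R = PiE I (\<lambda>_. {- K..K})"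
  have R: "R \<in> sets ?M" unfolding R_def by (intro sets_PiM_I_finite I) auto
  have form: "form s (x(l := y)) w = a x + y * b" for x y
  proof -
    have "(\<Sum>i\<in>insert l I. (x(l := y)) i * w (Suc i)) = y * b + (\<Sum>i\<in>I. (x(l := y)) i * w (Suc i))"
      unfolding sum.insert[OF I(2,3)] by (simp add: b_def)
    also have "(\<Sum>i\<in>I. (x(l := y)) i * w (Suc i)) = (\<Sum>i\<in>I. x i * w (Suc i))"
      using I by (intro sum.cong) auto
    finally show ?thesis by (simp add: form_def a_def I)
  qed
  have "emeasure (PiM {..<s} (\<lambda>_. lborel)) (strip s K w \<epsilon>)
      = (\<integral>\<^sup>+ x. indicator (strip s K w \<epsilon>) x \<partial>PiM {..<s} (\<lambda>_. lborel))"
    by simp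
  also have "\<dots> = (\<integral>\<^sup>+ x. \<integral>\<^sup>+ y. indicator (strip s K w \<epsilon>) (x(l := y)) \<partial>lborel \<partial>?M)"
    unfolding I(1)[symmetric] using I by (intro lborel_PiM.product_nn_integral_insert) auto
  \<comment> \<open>The bound by \<open>K\<close> on coordinate \<open>l\<close> is dropped;
    \<open>J x\<close> alone confines \<open>y\<close>.\<close>
  also have "\<dots> \<le> (\<integral>\<^sup>+ x. \<integral>\<^sup>+ y. indicator R x * indicator (J x) y \<partial>lborel \<partial>?M)"
  proof (intro nn_integral_mono)
    fix x y assume x: "x \<in> space ?M"
    show "indicator (strip s K w \<epsilon>) (x(l := y)) \<le> (indicator R x * indicator (J x) y :: ennreal)"
    proof (cases "x(l := y) \<in> strip s K w \<epsilon>")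
      case True
      then have in_cube: "\<forall>i<s. \<bar>(x(l := y)) i\<bar> \<le> K" and "\<bar>a x + y * b\<bar> \<le> \<epsilon>"
        by (auto simp: strip_def form)
      then have "\<bar>(a x + y * b) / b\<bar> \<le> \<epsilon> / \<bar>b\<bar>"
        by (simp add: divide_right_mono)
      then have "y \<in> J x" using b by (simp add: J_def add_divide_distrib abs_le_iff)
      moreover have "x \<in> R"
      proof -
        have "x i \<in> {- K..K}" if "i \<in> I" for i
        proof -
          have "i < s" "i \<noteq> l" using that by (auto simp: I_def)
          then show ?thesis using in_cube[rule_format, of i] by (simp add: abs_le_iff)
        qed
        then show ?thesis using x by (auto simp: R_def space_PiM PiE_iff)
      qed
      ultimately show ?thesis by (simp add: indicator_def)
    qed simp
  qed
  also have "\<dots> = (\<integral>\<^sup>+ x. indicator R x * ennreal (2 * \<epsilon> / \<bar>b\<bar>) \<partial>?M)"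
  proof (intro nn_integral_cong)
    fix x
    have "- a x / b - \<epsilon> / \<bar>b\<bar> \<le> - a x / b + \<epsilon> / \<bar>b\<bar>" using \<epsilon> by simp
    then have "emeasure lborel (J x) = ennreal (2 * \<epsilon> / \<bar>b\<bar>)" by (simp add: J_def)
    then show "(\<integral>\<^sup>+ y. indicator R x * indicator (J x) y \<partial>lborel)
        = indicator R x * ennreal (2 * \<epsilon> / \<bar>b\<bar>)"
      by (subst nn_integral_cmult) (auto simp: J_def)
  qed
  also have "\<dots> = emeasure ?M R * ennreal (2 * \<epsilon> / \<bar>b\<bar>)"
    using R by (subst nn_integral_multc) auto
  also have "\<dots> = ennreal ((2 * K) ^ (s - 1) * (2 * \<epsilon> / \<bar>b\<bar>))"
    unfolding R_def emeasure_cube[OF I(2) K] I(4) using K \<epsilon> by (subst ennreal_mult) auto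
  finally show ?thesis by (simp add: b_def)
qed

text \<open>Solving for \<open>w 0\<close> bounds it by \<epsilon> plus the contribution of the
  other entries. This serves to find a large slope in w and, later, to bound the norm of w.\<close>

lemma form_small_imp:
  assumes "\<forall>i\<in>{..<s}. \<bar>x i\<bar> \<le> K" and "\<bar>form s x w\<bar> \<le> \<epsilon>" and "0 \<le> K"
  shows "supn (Suc s) w \<le> \<epsilon> + (K * real s + 1) * supn s (\<lambda>l. w (Suc l))"
proof -
  let ?M = "supn s (\<lambda>l. w (Suc l))"
  have "\<bar>\<Sum>l<s. x l * w (Suc l)\<bar> \<le> (\<Sum>l<s. K * ?M)"
    using assms(1) abs_le_supn[of _ s "\<lambda>l. w (Suc l)"]
    by (intro order_trans[OF sum_abs] sum_mono) (auto simp: abs_mult intro!: mult_mono intro: order_trans[OF abs_ge_zero])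
  then have "\<bar>w 0\<bar> \<le> \<epsilon> + K * real s * ?M"
    using assms(2) by (simp add: form_def mult_ac)
  moreover have "0 \<le> \<epsilon>" using assms(2) by linarith
  moreover have "0 \<le> K * real s * ?M" using assms(3) by simp
  ultimately show ?thesis
    using supn_nonneg[of s "\<lambda>l. w (Suc l)"] unfolding supn_Suc
    by (simp add: algebra_simps del: supn_nonneg)
qed

text \<open>If w is at most 2 \<epsilon>, the bound exceeds the volume of the cube. Otherwise a
  nonempty strip forces a slope comparable to the whole norm of w, and integration in that
  coordinate applies.\<close>

lemma emeasure_strip_le:
  assumes w: "0 < supn (Suc s) w" and \<epsilon>: "0 \<le> \<epsilon>" and K: "1 \<le> K"
  shows "emeasure (PiM {..<s} (\<lambda>_. lborel)) (strip s K w \<epsilon>)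
    \<le> ennreal ((2 * K) ^ s * (4 * (K * real s + 1)) * (\<epsilon> / supn (Suc s) w))"
proof (cases "supn (Suc s) w \<le> 2 * \<epsilon>")
  case True
  let ?R = "PiE {..<s} (\<lambda>_. {- K..K})"
  have "emeasure (PiM {..<s} (\<lambda>_. lborel)) (strip s K w \<epsilon>) \<le> emeasure (PiM {..<s} (\<lambda>_. lborel)) ?R"
  proof (intro emeasure_mono subsetI)
    fix x assume "x \<in> strip s K w \<epsilon>"
    then have "\<forall>i<s. \<bar>x i\<bar> \<le> K" "x \<in> extensional {..<s}"
      by (auto simp: strip_def space_PiM PiE_iff)
    then show "x \<in> ?R" by (simp add: PiE_iff abs_le_iff minus_le_iff)
  qed (auto intro!: sets_PiM_I_finite)
  also have "\<dots> = ennreal ((2 * K) ^ s)" using K by (simp add: emeasure_cube)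
  also have "\<dots> \<le> ennreal ((2 * K) ^ s * (4 * (K * real s + 1)) * (\<epsilon> / supn (Suc s) w))"
  proof (rule ennreal_leI)
    have "1 \<le> 2 * (\<epsilon> / supn (Suc s) w)" using True w by (simp add: field_simps)
    also have "\<dots> \<le> (4 * (K * real s + 1)) * (\<epsilon> / supn (Suc s) w)"
      using K \<epsilon> by (intro mult_right_mono) auto
    finally have "(2 * K) ^ s * 1 \<le> (2 * K) ^ s * ((4 * (K * real s + 1)) * (\<epsilon> / supn (Suc s) w))"
      using K by (intro mult_left_mono) auto
    then show "(2 * K) ^ s \<le> (2 * K) ^ s * (4 * (K * real s + 1)) * (\<epsilon> / supn (Suc s) w)"
      by (simp add: mult.assoc)
  qed
  finally show ?thesis .
next
  case False
  show ?thesis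
  proof (cases "strip s K w \<epsilon> = {}")
    case nonempty: False
    define M where "M = supn s (\<lambda>l. w (Suc l))"
    define G where "G = K * real s + 1"
    have G: "1 \<le> G" using K by (simp add: G_def)
    have "supn (Suc s) w \<le> \<epsilon> + G * M"
      using nonempty form_small_imp K unfolding strip_def G_def M_def by fastforce
    \<comment> \<open>Here \<epsilon> is less than half the norm of w and is absorbed by the left
      side.\<close>
    then have GM: "supn (Suc s) w \<le> 2 * G * M" using False by linarith
    then have M: "0 < M" using w G by (smt (verit) mult_nonneg_nonpos)
    then obtain l where l: "l < s" "M = \<bar>w (Suc l)\<bar>"
      using supn_attained[of s "\<lambda>l. w (Suc l)"] by (auto simp: M_def)
    then have "emeasure (PiM {..<s} (\<lambda>_. lborel)) (strip s K w \<epsilon>)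
        \<le> ennreal ((2 * K) ^ (s - 1) * (2 * \<epsilon> / M))"
      using emeasure_strip_le_coordinate[of l s w \<epsilon> K] M \<epsilon> K by simp
    also have "\<dots> \<le> ennreal ((2 * K) ^ s * (4 * G) * (\<epsilon> / supn (Suc s) w))"
    proof (rule ennreal_leI)
      have "2 * \<epsilon> / M \<le> (4 * G) * (\<epsilon> / supn (Suc s) w)"
        using mult_left_mono[OF GM, of "2 * \<epsilon>"] M w \<epsilon> by (simp add: field_simps)
      moreover have "(2 * K) ^ (s - 1) \<le> (2 * K) ^ s" using K by (intro power_increasing) auto
      ultimately have "(2 * K) ^ (s - 1) * (2 * \<epsilon> / M) \<le> (2 * K) ^ s * ((4 * G) * (\<epsilon> / supn (Suc s) w))"
        using M \<epsilon> K by (intro mult_mono) auto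
      then show "(2 * K) ^ (s - 1) * (2 * \<epsilon> / M) \<le> (2 * K) ^ s * (4 * G) * (\<epsilon> / supn (Suc s) w)"
        by (simp add: mult.assoc)
    qed
    finally show ?thesis by (simp add: G_def)
  qed simp
qed

section \<open>Approximable matrices\<close>

lemma W_imp_VWA_affmap:
  assumes "s \<le> n" and W: "W u (s + 1) (n - s) A" and u: "real n < u"
  shows "VWA n (affmap s A x)"
proof -
  define k where "k = n - s"
  \<comment> \<open>Strictly between n and u, so that the gap u - v can absorb the constants
    \<open>D\<close> and \<open>C\<close>.\<close>
  define v where "v = (real n + u) / 2"
  have v: "real n < v" "v < u" "0 < v" using u by (auto simp: v_def field_simps)
  let ?N = "\<lambda>q. supn k (\<lambda>j. real_of_int (q j))"
  define D where "D = 1 + (\<Sum>l<s. \<bar>x l\<bar>)"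
  have D: "1 \<le> D" by (simp add: D_def sum_nonneg)
  define a where "a = (\<Sum>i<Suc s. \<Sum>j<k. \<bar>A i j\<bar>)"
  have a: "0 \<le> a" by (simp add: a_def sum_nonneg)
  define C where "C = 1 + a"
  have C: "1 \<le> C" using a by (simp add: C_def)
  \<comment> \<open>For norms N > Q one has D C^v <= N^(u - v), which turns D N^(-u) into at most (C
    N)^(-v).\<close>
  define Q where "Q = max 1 ((D * C powr v) powr (1 / (u - v)))"
  have "\<forall>q\<in>approx_set u (s + 1) k A. \<exists>p. supn (s + 1) (lin k A q p) \<le> ?N q powr (- u)"
    by (simp add: approx_set_def)
  then obtain P where P: "\<And>q. q \<in> approx_set u (s + 1) k A \<Longrightarrow>
      supn (s + 1) (lin k A q (P q)) \<le> ?N q powr (- u)"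
    by (rule bchoice[elim_format]) blast
  \<comment> \<open>The coefficient vector (p_1, ..., p_s, q), with p_0 left as constant term.
    Keeping q as a block makes \<open>emb\<close> injective.\<close>
  define emb :: "(nat \<Rightarrow> int) \<Rightarrow> nat \<Rightarrow> int"
    where "emb q = (\<lambda>i. if i < s then P q (Suc i) else q (i - s))" for q
  define S where "S = approx_set u (s + 1) k A - {q \<in> intvec k. ?N q \<le> Q}"
  have "infinite S"
    unfolding S_def using W finite_intvec_le by (auto simp: W_iff k_def)
  moreover have "inj_on emb S"
  proof (rule inj_onI)
    fix q q' assume "emb q = emb q'"
    then have "emb q (s + j) = emb q' (s + j)" for j by simp
    then show "q = q'" by (auto simp: emb_def)
  qed
  ultimately have "infinite (emb ` S)" by (simp add: finite_image_iff)
  moreover have "emb ` S \<subseteq> approx_set v 1 n (\<lambda>i j. affmap s A x j)"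
  proof safe
    fix q assume "q \<in> S"
    then have q: "q \<in> approx_set u (s + 1) k A" "q \<in> intvec k" "Q < ?N q"
      by (auto simp: S_def approx_set_def)
    have N: "1 < ?N q" using q(3) by (auto simp: Q_def)
    have w: "\<bar>lin k A q (P q) i\<bar> \<le> ?N q powr (- u)" if "i \<le> s" for i
      using P[OF q(1)] abs_le_supn[of i "s + 1"] that by (auto intro: order_trans)
    have "emb q \<in> intvec n" using q(2) \<open>s \<le> n\<close> by (auto simp: intvec_def emb_def k_def)
    have "?N q \<le> supn n (\<lambda>j. real_of_int (emb q j))"
    proof -
      have "\<bar>real_of_int (q j)\<bar> \<le> supn n (\<lambda>j. real_of_int (emb q j))" if "j < k" for j
        using abs_le_supn[of "s + j" n "\<lambda>j. real_of_int (emb q j)"] that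
        by (auto simp: emb_def k_def)
      then show ?thesis by (simp add: supn_le_iff)
    qed
    \<comment> \<open>Since w is at most 1 here, each entry of p is at most a N + 1 <= C N, where N
      is the norm of q.\<close>
    moreover have "supn n (\<lambda>j. real_of_int (emb q j)) \<le> C * ?N q"
    proof -
      have "\<bar>real_of_int (P q i)\<bar> \<le> C * ?N q" if "i \<le> s" for i
      proof -
        have "\<bar>\<Sum>j<k. A i j * real_of_int (q j)\<bar> \<le> (\<Sum>j<k. \<bar>A i j\<bar> * ?N q)"
          by (intro order_trans[OF sum_abs] sum_mono)
            (auto simp: abs_mult intro!: mult_left_mono abs_le_supn)
        also have "\<dots> = (\<Sum>j<k. \<bar>A i j\<bar>) * ?N q" by (simp add: sum_distrib_right)
        also have "(\<Sum>j<k. \<bar>A i j\<bar>) \<le> a"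
          unfolding a_def using that by (intro member_le_sum) (auto simp: sum_nonneg)
        finally have "\<bar>\<Sum>j<k. A i j * real_of_int (q j)\<bar> \<le> a * ?N q"
          by (simp add: mult_right_mono)
        moreover have "?N q powr (- u) \<le> ?N q powr 0"
          using N v by (intro powr_mono) auto
        ultimately show ?thesis using w[OF that] N by (simp add: lin_def C_def algebra_simps)
      qed
      moreover have "\<bar>real_of_int (q i)\<bar> \<le> C * ?N q" if "i < k" for i
        using abs_le_supn[OF that, of "\<lambda>j. real_of_int (q j)"] C mult_right_mono[of 1 C "?N q"]
        by simp
      ultimately show ?thesis using C \<open>s \<le> n\<close> by (auto simp: supn_le_iff emb_def k_def)
    qed
    moreover have "D * ?N q powr (- u) \<le> (C * ?N q) powr (- v)"
    proof -
      have "D * C powr v = ((D * C powr v) powr (1 / (u - v))) powr (u - v)"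
        using v D C by (simp add: powr_powr)
      also have "\<dots> \<le> ?N q powr (u - v)"
        using q(3) v by (intro powr_mono2) (auto simp: Q_def)
      finally have "D * C powr v * ?N q powr (- u) \<le> ?N q powr (u - v) * ?N q powr (- u)"
        by (intro mult_right_mono) auto
      also have "\<dots> = ?N q powr (- v)" using N by (simp flip: powr_add)
      finally show ?thesis using N C by (simp add: powr_mult powr_minus field_simps)
    qed
    moreover have "\<bar>form s x (lin k A q (P q))\<bar> \<le> D * ?N q powr (- u)"
      unfolding D_def using w by (intro abs_form_le) auto
    moreover have "form s x (lin k A q (P q)) =
        (\<Sum>j<n. affmap s A x j * real_of_int (emb q j)) + real_of_int (P q 0)"
      unfolding form_affmap[OF \<open>s \<le> n\<close>, where p = "P q"]
      by (auto simp: form_def lin_def emb_def k_def)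
    moreover have "(C * ?N q) powr (- v) \<le> supn n (\<lambda>j. real_of_int (emb q j)) powr (- v)"
      using calculation N v by (intro powr_mono2') auto
    ultimately have "supn 1 (lin n (\<lambda>i j. affmap s A x j) (emb q) (\<lambda>_. P q 0))
        \<le> supn n (\<lambda>j. real_of_int (emb q j)) powr (- v)"
      unfolding supn_1 by (simp add: lin_def)
    then show "emb q \<in> approx_set v 1 n (\<lambda>i j. affmap s A x j)"
      using \<open>emb q \<in> intvec n\<close> by (auto simp: approx_set_def)
  qed
  ultimately have "W v 1 n (\<lambda>i j. affmap s A x j)"
    by (auto simp: W_iff dest: finite_subset)
  then show ?thesis using v by (auto simp: VWA_def)
qed

lemma W_plus_imp_not_extremal:
  assumes "s \<le> n" and "W_plus (real n) (s + 1) (n - s) A"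
  shows "\<not> extremal s n (affmap s A)"
proof
  assume "extremal s n (affmap s A)"
  moreover have "VWA n (affmap s A x)" for x
    using assms W_imp_VWA_affmap by (auto simp: W_plus_def)
  ultimately have "AE x in PiM {..<s} (\<lambda>_. lborel :: real measure). False"
    by (simp add: extremal_def)
  then have "emeasure (PiM {..<s} (\<lambda>_. lborel :: real measure)) (space (PiM {..<s} (\<lambda>_. lborel))) = 0"
    by (auto simp: AE_iff_null null_setsD1)
  \<comment> \<open>The product is infinite, or 1 when s = 0; in either case it is not 0.\<close>
  moreover have "emeasure (PiM {..<s} (\<lambda>_. lborel :: real measure)) (space (PiM {..<s} (\<lambda>_. lborel)))
      = (\<Prod>i<s. \<infinity>)"
    unfolding space_PiM by (subst lborel_PiM.emeasure_PiM) auto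
  ultimately show False by simp
qed

section \<open>The convergence argument\<close>

text \<open>Each strip has measure at most a constant times \<epsilon> / |w|. The counting bound at
  every level of |w| controls the sum of 1 / |w| by a harmonic number, hence by a logarithm. Leaving
  out the zero pair keeps |w| positive.\<close>

lemma emeasure_UN_strip_le:
  fixes A :: "nat \<Rightarrow> nat \<Rightarrow> real" and T D K \<epsilon> c u :: real
  assumes u: "real (k + s) \<le> u" and c: "0 < c" "c \<le> 1"
    and low: "\<And>q p. q \<in> intvec k \<Longrightarrow> q \<noteq> (\<lambda>_. 0) \<Longrightarrow>
       c * supn k (\<lambda>j. real_of_int (q j)) powr (- u) \<le> supn (Suc s) (lin k A q p)"
    and T: "1 \<le> T" and D: "1 \<le> D" and K: "1 \<le> K" and \<epsilon>: "0 \<le> \<epsilon>"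
    and r: "r = c * T powr (- u)"
  defines "I \<equiv> {(q, p). q \<in> intvec k \<and> p \<in> intvec (Suc s) \<and> (q, p) \<noteq> (\<lambda>_. 0, \<lambda>_. 0) \<and>
     supn k (\<lambda>j. real_of_int (q j)) \<le> T \<and> supn (Suc s) (lin k A q p) \<le> D * T}"
  shows "finite I" and "emeasure (PiM {..<s} (\<lambda>_. lborel)) (\<Union>(q, p)\<in>I. strip s K (lin k A q p) \<epsilon>)
    \<le> ennreal ((2 * K) ^ s * (4 * (K * real s + 1)) * \<epsilon> *
        ((4 * D) ^ (k + Suc s) / r * (1 + ln ((4 * D) ^ (k + Suc s) * (D * T) / r))))"
proof -
  define f where "f = (\<lambda>(q, p). supn (Suc s) (lin k A q p))"
  define d where "d = k + Suc s"
  define B where "B = (4 * D) ^ d / r"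
  define P where "P \<rho> = {(q, p). q \<in> intvec k \<and> p \<in> intvec (Suc s) \<and>
     supn k (\<lambda>j. real_of_int (q j)) \<le> T \<and> supn (Suc s) (lin k A q p) \<le> \<rho>}" for \<rho>
  have r0: "0 < r" using r c T by simp
  have "T powr (- u) \<le> T powr 0" using T u by (intro powr_mono) auto
  then have "r \<le> c * 1" unfolding r using c T by (intro mult_left_mono) auto
  then have r1: "r \<le> 1" using c by linarith
  have DT: "1 \<le> D * T" using D T mult_mono[of 1 D 1 T] by simp
  have P: "finite (P \<rho>)" "real (card (P \<rho>)) \<le> B * \<rho>" if "r \<le> \<rho>" "\<rho> \<le> D * T" for \<rho>
  proof -
    have "1 \<le> d" "real d - 1 \<le> u" using u by (auto simp: d_def)
    note card_lin_points_le[OF d_def this c low T D r that]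
    then show "finite (P \<rho>)" "real (card (P \<rho>)) \<le> B * \<rho>" unfolding P_def B_def by simp_all
  qed
  have IP: "I \<subseteq> P (D * T)" by (auto simp: I_def P_def)
  have fin: "finite I" using IP P(1)[of "D * T"] r1 DT by (auto intro: finite_subset)
  then show "finite I" .
  \<comment> \<open>For q = 0 the vector w is the nonzero integer vector p, of norm at least 1 >= r;
    otherwise the lower bound on w applies.\<close>
  have f_ge: "r \<le> f z" if z: "z \<in> I" for z
  proof -
    obtain q p where [simp]: "z = (q, p)" by fastforce
    show ?thesis
    proof (cases "q = (\<lambda>_. 0)")
      case True
      then have "1 \<le> supn (Suc s) (\<lambda>i. real_of_int (p i))"
        using z by (intro supn_intvec_ge_1) (auto simp: I_def)
      then show ?thesis using r1 True by (simp add: f_def lin_def)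
    next
      case False
      have q: "q \<in> intvec k" "supn k (\<lambda>j. real_of_int (q j)) \<le> T" using z by (auto simp: I_def)
      have "r \<le> c * supn k (\<lambda>j. real_of_int (q j)) powr (- u)"
        unfolding r using supn_intvec_ge_1[OF q(1) False] q(2) u c
        by (intro mult_left_mono powr_mono2') auto
      also have "\<dots> \<le> f z" using low[OF q(1) False] by (simp add: f_def)
      finally show ?thesis .
    qed
  qed
  have f_pos: "0 < f z" if "z \<in> I" for z using f_ge[OF that] r0 by linarith
  have "real (card {y \<in> I. f y \<le> f z}) \<le> B * f z" if z: "z \<in> I" for z
  proof -
    have fz: "r \<le> f z" "f z \<le> D * T" using f_ge[OF z] z by (auto simp: I_def f_def)
    have "{y \<in> I. f y \<le> f z} \<subseteq> P (f z)" by (auto simp: I_def f_def P_def)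
    then have "card {y \<in> I. f y \<le> f z} \<le> card (P (f z))" using P(1)[OF fz] by (rule card_mono[rotated])
    then show ?thesis using P(2)[OF fz] by linarith
  qed
  then have sum_f: "(\<Sum>z\<in>I. 1 / f z) \<le> B * harm (card I)"
    using fin f_pos by (intro sum_inverse_le_harm) auto
  have B0: "0 \<le> B" using D r0 by (simp add: B_def)
  have cardI: "real (card I) \<le> B * (D * T)"
  proof -
    have "r \<le> D * T" using r1 DT by linarith
    then have "card I \<le> card (P (D * T))" "real (card (P (D * T))) \<le> B * (D * T)"
      using P[of "D * T"] card_mono[OF _ IP] by auto
    then show ?thesis by linarith
  qed
  \<comment> \<open>The empty index set is separate: its harmonic number is 0, so the logarithm must
    be seen to be nonnegative.\<close>
  have harm: "harm (card I) \<le> 1 + ln (B * (D * T))"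
  proof (cases "I = {}")
    case True
    have "1 \<le> (4 * D) ^ d" using D by (intro one_le_power) simp
    then have "1 * 1 \<le> (4 * D) ^ d * (D * T)" using DT by (intro mult_mono) auto
    then have "1 \<le> (4 * D) ^ d * (D * T)" by simp
    also have "\<dots> \<le> (4 * D) ^ d * (D * T) / r"
      using r0 r1 D DT by (simp add: le_divide_eq mult_left_le)
    finally have "1 \<le> B * (D * T)" by (simp add: B_def)
    then show ?thesis using True by (simp add: harm_def)
  next
    case False
    then have "1 \<le> card I" using fin by (simp add: Suc_leI card_gt_0_iff)
    then have "harm (card I) \<le> 1 + ln (real (card I))" by (rule harm_le_one_plus_ln)
    also have "ln (real (card I)) \<le> ln (B * (D * T))"
      using cardI \<open>1 \<le> card I\<close> by (intro ln_mono) auto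
    finally show ?thesis by simp
  qed
  define C where "C = (2 * K) ^ s * (4 * (K * real s + 1))"
  have C: "0 \<le> C" using K by (simp add: C_def)
  have "emeasure (PiM {..<s} (\<lambda>_. lborel)) (\<Union>(q, p)\<in>I. strip s K (lin k A q p) \<epsilon>)
      \<le> (\<Sum>z\<in>I. emeasure (PiM {..<s} (\<lambda>_. lborel)) (case z of (q, p) \<Rightarrow> strip s K (lin k A q p) \<epsilon>))"
    using fin by (intro emeasure_subadditive_finite) (auto simp: sets_strip)
  also have "\<dots> \<le> (\<Sum>z\<in>I. ennreal (C * (\<epsilon> / f z)))"
  proof (intro sum_mono)
    fix z assume z: "z \<in> I"
    obtain q p where [simp]: "z = (q, p)" by fastforce
    show "emeasure (PiM {..<s} (\<lambda>_. lborel)) (case z of (q, p) \<Rightarrow> strip s K (lin k A q p) \<epsilon>)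
        \<le> ennreal (C * (\<epsilon> / f z))"
      using emeasure_strip_le[of s "lin k A q p" \<epsilon> K] f_pos[OF z] \<epsilon> K by (simp add: f_def C_def)
  qed
  also have "\<dots> = ennreal (\<Sum>z\<in>I. C * (\<epsilon> / f z))"
    using C \<epsilon> by (intro sum_ennreal) (auto simp: f_def)
  also have "(\<Sum>z\<in>I. C * (\<epsilon> / f z)) = C * \<epsilon> * (\<Sum>z\<in>I. 1 / f z)"
    by (simp add: sum_distrib_left)
  also have "ennreal \<dots> \<le> ennreal (C * \<epsilon> * (B * (1 + ln (B * (D * T)))))"
    using order_trans[OF sum_f mult_left_mono[OF harm B0]] C \<epsilon>
    by (intro ennreal_leI mult_left_mono) auto
  finally show "emeasure (PiM {..<s} (\<lambda>_. lborel)) (\<Union>(q, p)\<in>I. strip s K (lin k A q p) \<epsilon>)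
    \<le> ennreal ((2 * K) ^ s * (4 * (K * real s + 1)) * \<epsilon> * ((4 * D) ^ (k + Suc s) / r * (1 + ln ((4 * D) ^ (k + Suc s) * (D * T) / r))))"
    by (simp add: B_def d_def C_def)
qed

text \<open>Solutions \<open>b\<close> are sorted into dyadic blocks 2^t <= |b| < 2^(t + 1). One in
  block t puts the point into \<open>F t\<close>; as u < v these sets have summable measure, so
  almost every point of the cube meets only finitely many of them.\<close>

lemma AE_finite_approx_set_affmap:
  assumes "s \<le> n" and not_W: "\<not> W u (s + 1) (n - s) A" and u: "real n < u" "u < v" and K: "1 \<le> K"
  shows "AE x in PiM {..<s} (\<lambda>_. lborel). (\<forall>i\<in>{..<s}. \<bar>x i\<bar> \<le> K) \<longrightarrow>
    finite (approx_set v 1 n (\<lambda>i j. affmap s A x j))"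
proof -
  define k where "k = n - s"
  have n: "n = k + s" using \<open>s \<le> n\<close> by (simp add: k_def)
  obtain c where c: "0 < c" "c \<le> 1" and low: "\<And>q p. q \<in> intvec k \<Longrightarrow> q \<noteq> (\<lambda>_. 0) \<Longrightarrow>
       c * supn k (\<lambda>j. real_of_int (q j)) powr (- u) \<le> supn (Suc s) (lin k A q p)"
    using not_W_lower_bound[OF not_W] unfolding k_def Suc_eq_plus1 by blast
  define a where "a = (\<Sum>i<Suc s. \<Sum>j<k. \<bar>A i j\<bar>)"
  have a: "0 \<le> a" by (simp add: a_def sum_nonneg)
  \<comment> \<open>Chosen so that every solution in block t has |w| <= D T: the leading 1 covers
    \<epsilon> <= 1, and 1 + a bounds the slopes of w relative to T.\<close>
  define D where "D = 1 + (K * real s + 1) * (1 + a)"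
  have D: "1 \<le> D" using a K by (simp add: D_def)
  \<comment> \<open>\<open>T t\<close> is the upper end of block t and bounds the coefficients;
    \<open>\<epsilon> t\<close> is taken at the lower end 2^t, where |b|^(-v) is largest.\<close>
  define T where "T t = (2::real) ^ Suc t" for t
  have T: "1 \<le> T t" for t unfolding T_def by (rule one_le_power) simp
  define r where "r t = c * T t powr (- u)" for t
  define \<epsilon> where "\<epsilon> t = ((2::real) ^ t) powr (- v)" for t
  define I where "I t = {(q, p). q \<in> intvec k \<and> p \<in> intvec (Suc s) \<and> (q, p) \<noteq> (\<lambda>_. 0, \<lambda>_. 0) \<and>
     supn k (\<lambda>j. real_of_int (q j)) \<le> T t \<and> supn (Suc s) (lin k A q p) \<le> D * T t}" for t
  define F where "F t = (\<Union>(q, p)\<in>I t. strip s K (lin k A q p) (\<epsilon> t))" for t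
  let ?M = "PiM {..<s} (\<lambda>_::nat. lborel :: real measure)"
  define C where "C = (2 * K) ^ s * (4 * (K * real s + 1))"
  have C: "0 \<le> C" using K by (simp add: C_def)
  define E where "E = (4 * D) ^ (k + Suc s)"
  have E: "1 \<le> E" unfolding E_def using D by (intro one_le_power) simp
  have "real (k + s) \<le> u" "0 \<le> \<epsilon> t" for t using u n by (auto simp: \<epsilon>_def)
  note UN_strip = emeasure_UN_strip_le[OF this(1) c low T D K this(2) r_def]
  have fin_I: "finite (I t)"
    and F_le: "emeasure ?M (F t) \<le> ennreal (C * \<epsilon> t * (E / r t * (1 + ln (E * (D * T t) / r t))))" for t
    using UN_strip(1)[of t] UN_strip(2)[of t t] unfolding I_def F_def C_def E_def by simp_all
  have [measurable]: "F t \<in> sets ?M" for t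
    unfolding F_def using fin_I by (intro sets.finite_UN) auto
  define x where "x = (2::real) powr (u - v)"
  have x: "0 < x" "x < 1" unfolding x_def using u by (auto simp: powr_less_one)
  \<comment> \<open>The logarithm grows linearly in t, so it is at most H (t + 1); the ratio
    \<epsilon> / r decays like x^t.\<close>
  define H where "H = 1 + ln (E * D / c) + (1 + u) * ln 2"
  define G where "G = C * E * 2 powr u / c * H"
  have bound: "C * \<epsilon> t * (E / r t * (1 + ln (E * (D * T t) / r t))) \<le> G * (real (Suc t) * x ^ t)" for t
  proof -
    have Tp: "T t = 2 powr real (Suc t)" unfolding T_def by (subst powr_realpow) auto
    have rt: "r t = c * 2 powr (- u * real (Suc t))"
      unfolding r_def Tp powr_powr by (simp add: mult.commute)
    have \<epsilon>t: "\<epsilon> t = 2 powr (- v * real t)"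
      unfolding \<epsilon>_def by (simp add: powr_powr mult.commute flip: powr_realpow)
    have "\<epsilon> t / r t = 2 powr u / c * 2 powr ((u - v) * real t)"
      unfolding \<epsilon>t rt using c
      by (simp add: field_simps powr_minus flip: powr_add)
    also have "2 powr ((u - v) * real t) = x ^ t"
      unfolding x_def by (simp add: powr_powr flip: powr_realpow)
    finally have \<epsilon>r: "\<epsilon> t / r t = 2 powr u / c * x ^ t" .
    have "2 powr real (Suc t) / 2 powr (- u * real (Suc t)) = 2 powr ((1 + u) * real (Suc t))"
      unfolding powr_diff[symmetric] by (simp add: algebra_simps)
    then have "E * (D * T t) / r t = E * D / c * 2 powr ((1 + u) * real (Suc t))"
      unfolding rt Tp by (metis times_divide_times_eq mult.assoc)
    then have "ln (E * (D * T t) / r t) = ln (E * D / c * 2 powr ((1 + u) * real (Suc t)))"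
      by simp
    also have "\<dots> = ln (E * D / c) + (1 + u) * ln 2 * real (Suc t)"
      using E D c by (subst ln_mult) (auto simp: ln_powr)
    finally have ln_eq: "ln (E * (D * T t) / r t) = ln (E * D / c) + (1 + u) * ln 2 * real (Suc t)" .
    have "1 \<le> E * D / c"
      using E D c mult_mono[of 1 E 1 D] by (simp add: le_divide_eq)
    then have "0 \<le> ln (E * D / c)" by simp
    then have "ln (E * D / c) * 1 \<le> ln (E * D / c) * real (Suc t)" by (intro mult_left_mono) auto
    then have "1 + ln (E * (D * T t) / r t) \<le> H * real (Suc t)"
      unfolding ln_eq H_def by (simp add: algebra_simps)
    then have "C * E * (\<epsilon> t / r t) * (1 + ln (E * (D * T t) / r t))
        \<le> C * E * (\<epsilon> t / r t) * (H * real (Suc t))"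
      using C E c by (intro mult_left_mono) (auto simp: \<epsilon>_def r_def)
    also have "\<dots> = G * (real (Suc t) * x ^ t)" unfolding \<epsilon>r by (simp add: G_def)
    finally show ?thesis by (simp add: mult_ac)
  qed
  have F_bound: "emeasure ?M (F t) \<le> ennreal (G * (real (Suc t) * x ^ t))" for t
    using F_le bound by (meson ennreal_leI order_trans)
  have G: "0 \<le> G"
  proof -
    have "1 \<le> E * D / c"
      using E D c mult_mono[of 1 E 1 D] by (simp add: le_divide_eq)
    then have "0 \<le> H" using u by (simp add: H_def)
    then show ?thesis using C E c by (simp add: G_def)
  qed
  have "AE x in ?M. eventually (\<lambda>t. x \<in> space ?M - F t) sequentially"
  proof (rule borel_cantelli_AE1)
    show "emeasure ?M (F t) < \<infinity>" for t
      using F_bound[of t] by (simp add: order_le_less_trans)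
    show "summable (\<lambda>t. measure ?M (F t))"
    proof (rule summable_comparison_test')
      show "summable (\<lambda>t. G * (real (Suc t) * x ^ t))"
        using geometric_deriv_sums[of x] x by (intro summable_mult) (auto simp: sums_iff)
      show "norm (measure ?M (F t)) \<le> G * (real (Suc t) * x ^ t)" if "0 \<le> t" for t
        using F_bound[of t] G x by (simp add: measure_def enn2real_leI)
    qed
  qed simp
  then show ?thesis
  proof (rule AE_mp, intro AE_I2 impI)
    fix x assume x: "x \<in> space ?M" and ev: "eventually (\<lambda>t. x \<in> space ?M - F t) sequentially"
      and xK: "\<forall>i\<in>{..<s}. \<bar>x i\<bar> \<le> K"
    obtain t0 where t0: "\<And>t. t0 \<le> t \<Longrightarrow> x \<notin> F t" using ev by (auto simp: eventually_sequentially)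
    let ?N = "\<lambda>q. supn n (\<lambda>j. real_of_int (q j))"
    have "approx_set v 1 n (\<lambda>i j. affmap s A x j) \<subseteq> {b \<in> intvec n. ?N b \<le> 2 ^ t0}"
    proof (rule subsetI, rule ccontr)
      fix b assume b: "b \<in> approx_set v 1 n (\<lambda>i j. affmap s A x j)"
        and "b \<notin> {b \<in> intvec n. ?N b \<le> 2 ^ t0}"
      then have biv: "b \<in> intvec n" and big: "2 ^ t0 < ?N b" by (auto simp: approx_set_def)
      obtain p where p: "\<bar>(\<Sum>j<n. affmap s A x j * real_of_int (b j)) + real_of_int (p 0)\<bar>
          \<le> ?N b powr (- v)"
        using b unfolding approx_set_def supn_1 by (auto simp: lin_def)
      define q where "q = (\<lambda>j. b (s + j))"
      \<comment> \<open>Entries beyond s are cut off so that \<open>p'\<close> lies in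
        \<open>intvec (Suc s)\<close>; the form does not see them.\<close>
      define p' where "p' = (\<lambda>i. if i = 0 then p 0 else if i \<le> s then b (i - 1) else 0)"
      have form_le: "\<bar>form s x (lin k A q p')\<bar> \<le> ?N b powr (- v)"
      proof -
        have "form s x (lin k A q p') = form s x (lin k A q (\<lambda>i. if i = 0 then p 0 else b (i - 1)))"
          by (auto simp: form_def lin_def p'_def)
        then show ?thesis using p unfolding form_affmap[OF \<open>s \<le> n\<close>] by (simp add: k_def q_def)
      qed
      obtain N where N: "?N b = real N" using supn_intvec_eq_of_nat by blast
      have "2 ^ t0 < N" using big unfolding N by simp
      then have "1 \<le> N" by (metis One_nat_def Suc_leI less_trans zero_less_numeral zero_less_power)
      then obtain t where t: "2 ^ t \<le> N" "N < 2 ^ (t + 1)" using ex_power_ivl1[of 2 N] by auto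
      have "(2::nat) ^ t0 < 2 ^ (t + 1)" using \<open>2 ^ t0 < N\<close> t(2) by (rule less_trans)
      then have "t0 < t + 1" by (rule power_less_imp_less_exp[rotated]) simp
      then have "t0 \<le> t" by simp
      have "2 ^ t \<le> real N" "real N \<le> T t"
      proof -
        have "real (2 ^ t) \<le> real N" "real N \<le> real (2 ^ (t + 1))"
          using t by (simp_all only: of_nat_le_iff less_imp_le)
        then show "2 ^ t \<le> real N" "real N \<le> T t" by (simp_all add: T_def)
      qed
      then have tN: "2 ^ t \<le> ?N b" "?N b \<le> T t" unfolding N by auto
      have "?N b powr (- v) \<le> \<epsilon> t"
        unfolding \<epsilon>_def using tN u by (intro powr_mono2') auto
      then have form_eps: "\<bar>form s x (lin k A q p')\<bar> \<le> \<epsilon> t" using form_le by linarith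
      have "\<epsilon> t \<le> 1"
        using powr_mono2'[of "- v" 1 "2 ^ t"] u by (simp add: \<epsilon>_def)
      have b_le: "\<bar>real_of_int (b j)\<bar> \<le> T t" if "j < n" for j
        using abs_le_supn[OF that, of "\<lambda>j. real_of_int (b j)"] tN by linarith
      have "supn s (\<lambda>l. lin k A q p' (Suc l)) \<le> (1 + a) * T t"
      proof -
        have "\<bar>lin k A q p' (Suc l)\<bar> \<le> (1 + a) * T t" if "l < s" for l
        proof -
          have "\<bar>\<Sum>j<k. A (Suc l) j * real_of_int (q j)\<bar> \<le> (\<Sum>j<k. \<bar>A (Suc l) j\<bar> * T t)"
            using b_le n by (intro order_trans[OF sum_abs] sum_mono)
              (auto simp: abs_mult q_def intro!: mult_left_mono)
          also have "\<dots> = (\<Sum>j<k. \<bar>A (Suc l) j\<bar>) * T t" by (simp add: sum_distrib_right)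
          also have "\<dots> \<le> a * T t"
            unfolding a_def using that T[of t]
            by (intro mult_right_mono member_le_sum) (auto simp: sum_nonneg)
          finally have "\<bar>\<Sum>j<k. A (Suc l) j * real_of_int (q j)\<bar> \<le> a * T t" .
          moreover have "\<bar>real_of_int (p' (Suc l))\<bar> \<le> T t"
            using b_le[of l] that n by (simp add: p'_def)
          ultimately show ?thesis by (simp add: lin_def algebra_simps)
        qed
        then show ?thesis using a T[of t] by (simp add: supn_le_iff)
      qed
      then have "(K * real s + 1) * supn s (\<lambda>l. lin k A q p' (Suc l)) \<le> (K * real s + 1) * ((1 + a) * T t)"
        using K by (intro mult_left_mono) auto
      moreover have "supn (Suc s) (lin k A q p')
          \<le> \<epsilon> t + (K * real s + 1) * supn s (\<lambda>l. lin k A q p' (Suc l))"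
        using form_small_imp[OF xK form_eps] K by simp
      ultimately have "supn (Suc s) (lin k A q p') \<le> D * T t"
        using \<open>\<epsilon> t \<le> 1\<close> T[of t] by (simp add: D_def algebra_simps)
      moreover have "supn k (\<lambda>j. real_of_int (q j)) \<le> T t"
        using b_le n T[of t] by (simp add: supn_le_iff q_def)
      moreover have "q \<in> intvec k" "p' \<in> intvec (Suc s)"
        using biv n by (auto simp: intvec_def q_def p'_def)
      moreover have "(q, p') \<noteq> (\<lambda>_. 0, \<lambda>_. 0)"
      proof
        assume "(q, p') = (\<lambda>_. 0, \<lambda>_. 0)"
        then have q0: "q j = 0" and p0: "p' j = 0" for j by auto
        have "b j = 0" for j
          using q0[of "j - s"] p0[of "Suc j"] by (cases "j < s") (auto simp: q_def p'_def)
        then have "?N b = 0" using supn_attained[of n "\<lambda>j. real_of_int (b j)"] by auto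
        moreover have "(0::real) < 2 ^ t0" by simp
        ultimately show False using big by linarith
      qed
      ultimately have "(q, p') \<in> I t" by (simp add: I_def)
      moreover have "x \<in> strip s K (lin k A q p') (\<epsilon> t)"
        using x xK form_eps by (simp add: strip_def)
      ultimately have "x \<in> F t" unfolding F_def by blast
      then show False using t0[OF \<open>t0 \<le> t\<close>] by simp
    qed
    then show "finite (approx_set v 1 n (\<lambda>i j. affmap s A x j))"
      using finite_intvec_le by (rule finite_subset)
  qed
qed

text \<open>Countably many exponents tending to n and countably many cubes suffice, so the
  exceptional null sets can be united.\<close>

lemma not_W_plus_imp_extremal:
  assumes "s \<le> n" and not_W: "\<not> W_plus (real n) (s + 1) (n - s) A"
  shows "extremal s n (affmap s A)"
proof -
  let ?M = "PiM {..<s} (\<lambda>_::nat. lborel :: real measure)"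
  let ?fin = "\<lambda>v x. finite (approx_set v 1 n (\<lambda>i j. affmap s A x j))"
  define v where "v i = real n + 1 / real (Suc i)" for i
  have "AE x in ?M. (\<forall>l\<in>{..<s}. \<bar>x l\<bar> \<le> real (Suc N)) \<longrightarrow> ?fin (v i) x" for i N
  proof (rule AE_finite_approx_set_affmap[OF \<open>s \<le> n\<close>])
    \<comment> \<open>The next term of the sequence \<open>v\<close> supplies an exponent strictly
      between n and \<open>v i\<close>.\<close>
    show "\<not> W (real n + 1 / real (Suc (Suc i))) (s + 1) (n - s) A"
      using not_W by (auto simp: W_plus_def)
  qed (auto simp: v_def field_simps)
  then have "AE x in ?M. \<forall>i N. (\<forall>l\<in>{..<s}. \<bar>x l\<bar> \<le> real (Suc N)) \<longrightarrow> ?fin (v i) x"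
    unfolding AE_all_countable by (intro allI)
  then show ?thesis unfolding extremal_def
  proof (rule AE_mp, intro AE_I2 impI notI)
    fix x assume x: "\<forall>i N. (\<forall>l\<in>{..<s}. \<bar>x l\<bar> \<le> real (Suc N)) \<longrightarrow> ?fin (v i) x"
      and "VWA n (affmap s A x)"
    then obtain v' where v': "real n < v'" "\<not> ?fin v' x" by (auto simp: VWA_def W_iff)
    obtain i where "1 / real (Suc i) < v' - real n"
      using v'(1) nat_approx_posE[of "v' - real n"] by auto
    then have "v i \<le> v'" by (simp add: v_def)
    then have fin_mono: "?fin (v i) x \<Longrightarrow> ?fin v' x"
      by (rule finite_subset[OF approx_set_antimono])
    obtain N where "supn s x \<le> real N" using real_arch_simple by blast
    then have "\<forall>l\<in>{..<s}. \<bar>x l\<bar> \<le> real (Suc N)" by (fastforce simp: supn_le_iff)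
    then have "?fin (v i) x" using x by blast
    then show False using fin_mono v'(2) by simp
  qed
qed

theorem theorem1p3:
  fixes s n :: nat and A :: "nat \<Rightarrow> nat \<Rightarrow> real"
  assumes "1 \<le> s" and "s \<le> n - 1"
    and "s = n - 1 \<or> (s = 1 \<and> (\<forall>j < n - s. A 0 j = 0))"
  shows "extremal s n (affmap s A) \<longleftrightarrow> \<not> W_plus (real n) (s + 1) (n - s) A"
proof -
  have "s \<le> n" using assms(2) by simp
  then show ?thesis using W_plus_imp_not_extremal not_W_plus_imp_extremal by blast
qed

end
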